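(* For every integer $s\ge1$, as formal power series in $y$, $$\Psi_s^{\mathrm{cyc}}(y)=\frac{(s+2)\,P_{s+1}(-y)}{2\,Q_{s+2}(-y)},\qquad \Omega_s^{\mathrm{cyc}}(y)=\frac{\mathcal R_s(y)-\bigl(\lfloor s/2\rfloor+1\bigr)Q_{s+2}(-y)}{y\,Q_{s+2}(-y)},$$ where $\mathcal R_s(y)$ is the explicit polynomial given in the context. Furthermore, let $$\alpha_s:=\frac{\pi}{2(s+2)},\qquad y_s^*:=\tan^2\alpha_s,\qquad \xi_s:=\frac{2\,\mathcal R_s(y_s^* )\sin\alpha_s\cos^{s-1}\alpha_s}{(s+2)\,y_s^*}.$$ Then, as $m\to\infty$, $$N_{2m}^{\mathrm{cyc}}(s)\sim (y_s^* )^{-m},\qquad N_{2m+1}^{\mathrm{cyc}}(s)\sim\xi_s\,(y_s^* )^{-m}.$$ In particular, the leading constant in the even cyclic parity class is exactly $1$.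
   Context: For integers $d\ge2$ and $s\ge1$ let $$\mathcal P_d^{(s)}=\{x=(x_1,\dots,x_d)\in\mathbb R_{\ge0}^d:\ x_i+x_{i+1}\le s+\delta_i,\ 1\le i\le d-1\},$$ where $\delta_i=0$ for $i$ odd and $\delta_i=1$ for $i$ even. Define $$N_d^{\mathrm{cyc}}(s):=\#\bigl(\{x\in\mathcal P_d^{(s)}:\ x_d+x_1\le s+\delta_d\}\cap\mathbb Z^d\bigr),$$ $$\Psi_s^{\mathrm{cyc}}(y):=\sum_{m\ge1}N_{2m}^{\mathrm{cyc}}(s)\,y^{m-1},\qquad \Omega_s^{\mathrm{cyc}}(y):=\sum_{m\ge1}N_{2m+1}^{\mathrm{cyc}}(s)\,y^{m-1}.$$ Define the polynomials $$P_n(y):=\sum_{k=0}^{\lfloor (n-1)/2\rfloor}\binom{n}{2k+1}y^k,\qquad Q_n(y):=\sum_{k=0}^{\lfloor n/2\rfloor}\binom{n}{2k}y^k.$$ Put $W=1+y$ and $\widehat P_n=P_n(-y)$ (empty sums are $0$). The polynomial $\mathcal R_s(y)$ is: if $s=2\ell$, $$\mathcal R_{2\ell}(y)=\frac12\sum_{r=1}^{\ell}(1+W^{2\ell+2-2r})\widehat P_{2r}+\frac12\widehat P_{2\ell+2}-\frac12\sum_{r=1}^{\ell}(1+W^{2\ell+1-2r})(\widehat P_{2r+1}-W^r);$$ if $s=2\ell+1$, $$\mathcal R_{2\ell+1}(y)=\frac12\sum_{r=1}^{\ell+1}(1+W^{2\ell+3-2r})\widehat P_{2r}-\frac12\sum_{r=1}^{\ell}(1+W^{2\ell+2-2r})(\widehat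 P_{2r+1}-W^r)-\frac12(\widehat P_{2\ell+3}-W^{\ell+1}).$$ The notation $f(m)\sim g(m)$ means $f(m)/g(m)\to1$. *)

theory Defs
  imports
    Complex_Main
    "HOL-Library.FuncSet"
    "HOL-Library.Landau_Symbols"
    "HOL-Computational_Algebra.Computational_Algebra"
begin

definition delta :: "nat \<Rightarrow> nat" where
  "delta i = (if odd i then 0 else 1)"

(* The dimension d varies within the generating functions, so a point of R^d is a function on
   the index set {1..d}, extended by undefined outside it (so that equal points are equal
   functions and cardinalities are meaningful). *)

definition zz_polytope :: "nat \<Rightarrow> nat \<Rightarrow> (nat \<Rightarrow> real) set" where
  "zz_polytope s d =
     {x \<in> {1..d} \<rightarrow>\<^sub>E {0..}. \<forall>i\<in>{1..d-1}. x i + x (i + 1) \<le> real (s + delta i)}"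

definition integer_points :: "nat \<Rightarrow> (nat \<Rightarrow> real) set" where
  "integer_points d = {1..d} \<rightarrow>\<^sub>E \<int>"

definition N_cyc :: "nat \<Rightarrow> nat \<Rightarrow> nat" where
  "N_cyc s d =
     card ({x \<in> zz_polytope s d. x d + x 1 \<le> real (s + delta d)} \<inter> integer_points d)"

(* The sums over m \<ge> 1 of N y^(m-1) are indexed by n = m - 1. *)

definition Psi_cyc :: "nat \<Rightarrow> real fps" where
  "Psi_cyc s = Abs_fps (\<lambda>n. real (N_cyc s (2 * (n + 1))))"

definition Omega_cyc :: "nat \<Rightarrow> real fps" where
  "Omega_cyc s = Abs_fps (\<lambda>n. real (N_cyc s (2 * (n + 1) + 1)))"

(* For n = 0 the truncated upper bound leaves the single term k = 0, which is (0 choose 1) = 0. *)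

definition P_poly :: "nat \<Rightarrow> real poly" where
  "P_poly n = (\<Sum>k=0..(n - 1) div 2. monom (real (n choose (2 * k + 1))) k)"

definition Q_poly :: "nat \<Rightarrow> real poly" where
  "Q_poly n = (\<Sum>k=0..n div 2. monom (real (n choose (2 * k))) k)"

definition P_hat :: "nat \<Rightarrow> real poly" where
  "P_hat n = pcompose (P_poly n) [:0, -1:]"

definition Q_hat :: "nat \<Rightarrow> real poly" where
  "Q_hat n = pcompose (Q_poly n) [:0, -1:]"

definition W_poly :: "real poly" where
  "W_poly = [:1, 1:]"

definition R_poly :: "nat \<Rightarrow> real poly" where
  "R_poly s = (let l = s div 2; W = W_poly in
     if even s then
         smult (1/2) (\<Sum>r=1..l. (1 + W ^ (2*l + 2 - 2*r)) * P_hat (2*r))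
       + smult (1/2) (P_hat (2*l + 2))
       - smult (1/2) (\<Sum>r=1..l. (1 + W ^ (2*l + 1 - 2*r)) * (P_hat (2*r + 1) - W ^ r))
     else
         smult (1/2) (\<Sum>r=1..l+1. (1 + W ^ (2*l + 3 - 2*r)) * P_hat (2*r))
       - smult (1/2) (\<Sum>r=1..l. (1 + W ^ (2*l + 2 - 2*r)) * (P_hat (2*r + 1) - W ^ r))
       - smult (1/2) (P_hat (2*l + 3) - W ^ (l + 1)))"

definition alpha :: "nat \<Rightarrow> real" where
  "alpha s = pi / (2 * (real s + 2))"

definition y_star :: "nat \<Rightarrow> real" where
  "y_star s = (tan (alpha s))\<^sup>2"

definition xi :: "nat \<Rightarrow> real" where
  "xi s = 2 * poly (R_poly s) (y_star s) * sin (alpha s) * cos (alpha s) ^ (s - 1)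
            / ((real s + 2) * y_star s)"

end

theory Submission
  imports Defs
begin

text \<open>
  In positive dimension, all coordinates of a point counted by \<open>N_cyc\<close> lie between 0 and \<open>s\<close>,
  and the point is a closed walk: with the matrices \<open>A = [a + b \<le> s]\<close> and \<open>B = [a + b \<le> s + 1]\<close>, indexed by \<open>0, \<dots>, s\<close>, the count
  is the trace of \<open>(A B) ^ m\<close> in dimension \<open>2 m\<close> and the trace of \<open>(A B) ^ m A\<close> in dimension
  \<open>2 m + 1\<close>. Both generating functions are therefore read off from the resolvent
  \<open>G = (1 - y A B)\<^sup>-\<^sup>1 A\<close>: they are the traces of \<open>G B\<close> and of \<open>G\<close>.

  Up to reversal of the rows, \<open>A\<close> is triangular with all ones and its inverse is a difference
  operator, so the equation for \<open>G\<close> becomes, after one more difference, a second-order recurrence which,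
  read backwards, has the characteristic roots \<open>1 \<plusminus> \<surd>(-y)\<close>. The polynomials \<open>Q_hat n\<close> and
  \<open>P_hat n\<close> are the even part of \<open>(1 + \<surd>(-y)) ^ n\<close> and its odd part divided by \<open>\<surd>(-y)\<close>, hence
  solutions; with \<open>y = tan\<^sup>2 \<theta>\<close> they are \<open>cos (n \<theta>)\<close> and \<open>sin (n \<theta>)\<close> up to
  elementary factors. This gives the entries of \<open>G\<close> in closed form (\<open>green\<close>), as products of
  two cosines or two sines over the denominator \<open>Q_hat (s + 2)\<close>. That they are right follows by
  telescoping (\<open>green_eq\<close>) and uniqueness of the solution as a power series
  (\<open>walk_fps_eq_green\<close>). The two traces are evaluated by the addition theorem (\<open>sum_green_even\<close>)
  and by linearising squares (\<open>sum_green_diag\<close>).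

  For the asymptotics, the zeros of \<open>Q_hat (s + 2)\<close> are the values of \<open>tan\<^sup>2\<close> at the odd multiples
  of \<open>alpha s\<close> below \<open>\<pi>/2\<close>. They are simple and \<open>y_star s\<close> is the smallest, so the coefficients
  of both series, multiplied by \<open>y_star s ^ m\<close>, converge to limits given by the residues at this
  pole (\<open>coefficient_limit\<close>). In the even case the residue is that of a logarithmic derivative,
  whence the constant 1. In the odd case the limit is \<open>xi s\<close>, and it is positive because
  \<open>R_poly s\<close> is a weighted sum of squares (\<open>R_poly_pos\<close>).
\<close>

section \<open>The polynomials P and Q at -y\<close>

definition Y_poly :: "real poly" where
  "Y_poly = [:0, 1:]"

lemma W_poly_eq: "W_poly = 1 + Y_poly"
  by (simp add: W_poly_def Y_poly_def one_pCons)

lemma coeff_Q_poly: "coeff (Q_poly n) k = real (n choose (2 * k))"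
proof -
  have "n choose (2 * k) = 0" if "\<not> k \<le> n div 2"
    using that by (intro binomial_eq_0) linarith
  then show ?thesis
    by (auto simp: Q_poly_def coeff_sum)
qed

lemma coeff_P_poly: "coeff (P_poly n) k = real (n choose (2 * k + 1))"
proof -
  have "n choose Suc (2 * k) = 0" if "\<not> k \<le> (n - 1) div 2"
    using that by (intro binomial_eq_0) linarith
  then show ?thesis
    by (auto simp: P_poly_def coeff_sum)
qed

lemma Q_poly_Suc: "Q_poly (Suc n) = Q_poly n + Y_poly * P_poly n"
proof (rule poly_eqI)
  fix k show "coeff (Q_poly (Suc n)) k = coeff (Q_poly n + Y_poly * P_poly n) k"
    by (cases k) (simp_all add: coeff_Q_poly coeff_P_poly Y_poly_def)
qed

lemma P_poly_Suc: "P_poly (Suc n) = P_poly n + Q_poly n"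
  by (rule poly_eqI) (simp add: coeff_Q_poly coeff_P_poly)

lemma P_hat_0 [simp]: "P_hat 0 = 0"
  by (simp add: P_hat_def P_poly_def)

lemma Q_hat_0 [simp]: "Q_hat 0 = 1"
  by (simp add: Q_hat_def Q_poly_def monom_0 pcompose_1 flip: one_pCons)

lemma P_hat_Suc: "P_hat (Suc n) = P_hat n + Q_hat n"
  by (simp add: P_hat_def Q_hat_def P_poly_Suc pcompose_add)

lemma Q_hat_Suc: "Q_hat (Suc n) = Q_hat n - Y_poly * P_hat n"
  by (simp add: P_hat_def Q_hat_def Q_poly_Suc pcompose_add pcompose_mult Y_poly_def pcompose_pCons)

text \<open>
  Since \<open>(1 + \<i> u) ^ n = Q_hat n + \<i> u P_hat n\<close> at \<open>y = u\<^sup>2\<close>, the rules for one step,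
  for a sum of exponents and for the square of the modulus are those of complex multiplication;
  they are the addition theorems of sine and cosine and the Pythagorean identity, cleared of
  denominators.
\<close>

lemma hat_add:
  "P_hat (m + n) = P_hat m * Q_hat n + Q_hat m * P_hat n"
  "Q_hat (m + n) = Q_hat m * Q_hat n - Y_poly * P_hat m * P_hat n"
  by (induction m) (simp_all add: P_hat_Suc Q_hat_Suc algebra_simps)

text \<open>
  The real part of multiplication by \<open>1 - \<i> u\<close> (\<open>W_P_hat\<close> is the imaginary part), which takes
  the \<open>(n + 1)\<close>-st power of \<open>1 + \<i> u\<close> back to \<open>W\<close> times the \<open>n\<close>-th one.
\<close>

lemma W_Q_hat: "W_poly * Q_hat n = Q_hat (Suc n) + Y_poly * P_hat (Suc n)"
  by (simp add: W_poly_eq P_hat_Suc Q_hat_Suc algebra_simps)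

lemma W_P_hat: "W_poly * P_hat n = P_hat (Suc n) - Q_hat (Suc n)"
  by (simp add: W_poly_eq P_hat_Suc Q_hat_Suc algebra_simps)

lemma W_power_hat: "W_poly ^ n = Q_hat n ^ 2 + Y_poly * P_hat n ^ 2"
  by (induction n) (simp_all add: W_poly_eq P_hat_Suc Q_hat_Suc power2_eq_square algebra_simps)

section \<open>The resolvent of the walk in closed form\<close>

text \<open>
  Numerators of the entries of the resolvent \<open>(1 - y A B)\<^sup>-\<^sup>1 A\<close> over the common denominator
  \<open>Q_hat (s + 2)\<close>. Apart from powers of \<open>cos \<theta>\<close>, where \<open>y = tan\<^sup>2 \<theta>\<close>, the first branch is
  \<open>cos ((a + 1) \<theta>) cos ((b + 1) \<theta>)\<close> and the second is
  \<open>sin ((s + 1 - a) \<theta>) sin ((s + 1 - b) \<theta>)\<close>: a Green's function, glued from two solutions of a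
  second-order recurrence. At \<open>a = s + 1\<close> or \<open>b = s + 1\<close> it vanishes because \<open>P_hat 0 = 0\<close>, so
  that summation ranges may run up to \<open>s + 1\<close> without a cut-off.
\<close>

definition green :: "nat \<Rightarrow> nat \<Rightarrow> nat \<Rightarrow> real poly" where
  "green s a b =
     (if a + b \<le> s then W_poly ^ (s - a - b) * Q_hat (a + 1) * Q_hat (b + 1)
      else Y_poly * P_hat (s + 1 - a) * P_hat (s + 1 - b))"

text \<open>
  The partial sums of a row telescope on both sides of the antidiagonal, because the one-step rules
  express each entry as a difference.
\<close>

lemma sum_green_below:
  assumes "a + k \<le> s"
  shows "(\<Sum>b\<le>k. green s a b) = W_poly ^ (s - a - k) * Q_hat (a + 1) * P_hat (k + 1)"
  using assms
proof (induction k)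
  case 0
  then show ?case by (simp add: green_def P_hat_Suc Q_hat_Suc)
next
  case (Suc k)
  define e where "e = s - a - Suc k"
  have e: "s - a - k = Suc e" using Suc.prems by (simp add: e_def)
  have g: "green s a (Suc k) = W_poly ^ e * Q_hat (a + 1) * Q_hat (Suc k + 1)"
    using Suc.prems by (simp add: green_def e_def)
  have "(\<Sum>b\<le>Suc k. green s a b)
      = W_poly ^ e * Q_hat (a + 1) * (W_poly * P_hat (k + 1) + Q_hat (Suc k + 1))"
    using Suc.IH Suc.prems unfolding sum.atMost_Suc g e by (simp add: algebra_simps)
  then show ?case by (simp add: W_P_hat e_def)
qed

lemma sum_green_above:
  assumes "s \<le> a + k" "k \<le> s + 1" "a \<le> s + 1"
  shows "(\<Sum>b\<le>k. green s a b) = P_hat (s + 1 - a) * Q_hat (s + 1 - k)"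
proof (cases "a = s + 1")
  case True
  then show ?thesis by (simp add: green_def)
next
  case False
  then have "s - a \<le> k" "a \<le> s" using assms by auto
  from this(1) assms(2) show ?thesis
  proof (induction k rule: dec_induct)
    case base
    then show ?case using sum_green_below[of a "s - a" s] \<open>a \<le> s\<close> by (simp add: Suc_diff_le)
  next
    case (step k)
    define j where "j = s - k"
    have j: "s + 1 - k = Suc j" "s + 1 - Suc k = j" using step by (auto simp: j_def)
    have g: "green s a (Suc k) = Y_poly * P_hat (s + 1 - a) * P_hat j"
      using step \<open>a \<le> s\<close> by (simp add: green_def j_def)
    have "(\<Sum>b\<le>Suc k. green s a b)
        = P_hat (s + 1 - a) * Q_hat (Suc j) + Y_poly * P_hat (s + 1 - a) * P_hat j"
      using step.IH step.prems unfolding sum.atMost_Suc g j by simp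
    also have "\<dots> = P_hat (s + 1 - a) * Q_hat j"
      by (simp add: Q_hat_Suc algebra_simps)
    finally show ?case unfolding j .
  qed
qed

text \<open>
  One application of the inverse of \<open>A\<close>, which is a difference operator up to reversal of the
  index. The denominator \<open>Q_hat (s + 2)\<close> enters at the antidiagonal, where the two branches meet,
  through the addition theorem with \<open>s + 2 = (a + 1) + (k + 1)\<close>.
\<close>

lemma green_diff:
  assumes "a \<le> s + 1" "k \<le> s"
  shows "green s a k - green s a (k + 1)
       = (if a + k = s then Q_hat (s + 2) else 0) + Y_poly * (\<Sum>b\<le>k+1. green s a b)"
proof -
  consider "a + k < s" | "a + k = s" | "s < a + k" by linarith
  then show ?thesis
  proof cases
    case 1
    define e where "e = s - a - (k + 1)"
    have e: "s - a - k = Suc e" "s - Suc (a + k) = e" using 1 by (auto simp: e_def)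
    have "green s a k - green s a (k + 1)
        = W_poly ^ e * Q_hat (a + 1) * (W_poly * Q_hat (k + 1) - Q_hat (k + 2))"
      using 1 e by (simp add: green_def algebra_simps)
    also have "\<dots> = Y_poly * (W_poly ^ e * Q_hat (a + 1) * P_hat (k + 2))"
      using W_Q_hat[of "k + 1"] by (simp add: algebra_simps)
    finally show ?thesis
      using 1 sum_green_below[of a "k + 1" s] by (simp add: e_def)
  next
    case 2
    have "green s a k - green s a (k + 1)
        = Q_hat (a + 1) * Q_hat (k + 1) - Y_poly * P_hat (k + 1) * P_hat a"
      using 2 by (auto simp: green_def)
    also have "\<dots> = Q_hat ((a + 1) + (k + 1)) + Y_poly * (P_hat (k + 1) * Q_hat a)"
      unfolding hat_add(2) by (simp add: P_hat_Suc algebra_simps)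
    finally show ?thesis
      using 2 assms sum_green_above[of s a "k + 1"] by auto
  next
    case 3
    define j where "j = s - k"
    have j: "s + 1 - k = Suc j" "s + 1 - (k + 1) = j" using assms by (auto simp: j_def)
    have "green s a k - green s a (k + 1)
        = Y_poly * P_hat (s + 1 - a) * (P_hat (Suc j) - P_hat j)"
      using 3 unfolding green_def j by (simp add: algebra_simps)
    also have "\<dots> = Y_poly * (P_hat (s + 1 - a) * Q_hat j)"
      by (simp add: P_hat_Suc)
    finally show ?thesis
      using 3 assms sum_green_above[of s a "k + 1"] unfolding j by simp
  qed
qed

text \<open>
  The resolvent equation \<open>G = A + y G (B A)\<close>, multiplied by the denominator: the sum over \<open>b'\<close>
  applies \<open>B\<close> and the sum over \<open>c\<close> applies \<open>A\<close>.
\<close>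

lemma green_eq:
  assumes "a \<le> s + 1" "b \<le> s"
  shows "green s a b
       = (if a + b \<le> s then Q_hat (s + 2) else 0)
         + Y_poly * (\<Sum>c\<le>s - b. \<Sum>b'\<le>s + 1 - c. green s a b')"
proof -
  have "green s a (s - j)
       = (if a \<le> j then Q_hat (s + 2) else 0)
         + Y_poly * (\<Sum>c\<le>j. \<Sum>b'\<le>s + 1 - c. green s a b')" if "j \<le> s" for j
    using that
  proof (induction j)
    case 0
    have "green s a (s + 1) = 0" by (simp add: green_def)
    then show ?case using green_diff[of a s s] assms by auto
  next
    case (Suc j)
    have [simp]: "Suc (s - Suc j) = s - j" "Suc s - Suc j = s - j" using Suc.prems by auto
    have "a + (s - Suc j) = s \<longleftrightarrow> a = Suc j" using Suc.prems by auto
    then show ?case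
      using green_diff[of a s "s - Suc j"] assms Suc by (auto simp: algebra_simps)
  qed
  from this[of "s - b"] show ?thesis using assms by (auto simp: le_diff_conv2)
qed

section \<open>The two traces of the resolvent\<close>

text \<open>
  Reversing the sum and averaging turns each term into the addition theorem for
  \<open>P_hat (a + (n - a))\<close>.
\<close>

lemma sum_Q_hat_P_hat:
  "2 * (\<Sum>a\<le>n. Q_hat a * P_hat (n - a)) = smult (real n + 1) (P_hat n)"
proof -
  have "(\<Sum>a\<le>n. Q_hat a * P_hat (n - a)) = (\<Sum>a\<le>n. P_hat a * Q_hat (n - a))"
    by (rule sum.reindex_bij_witness[of _ "\<lambda>a. n - a" "\<lambda>a. n - a"]) auto
  then have "2 * (\<Sum>a\<le>n. Q_hat a * P_hat (n - a))
      = (\<Sum>a\<le>n. P_hat a * Q_hat (n - a) + Q_hat a * P_hat (n - a))"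
    by (simp add: sum.distrib)
  also have "\<dots> = (\<Sum>a\<le>n. P_hat n)"
    by (intro sum.cong refl) (simp flip: hat_add(1))
  also have "\<dots> = smult (real n + 1) (P_hat n)"
    by (simp add: of_nat_poly smult_add_left algebra_simps)
  finally show ?thesis .
qed

text \<open>
  The trace of \<open>G B\<close>. By the choice of the upper limit each inner sum is
  \<open>P_hat (s + 1 - a) * Q_hat a\<close>.
\<close>

lemma sum_green_even:
  "2 * (\<Sum>a\<le>s + 1. \<Sum>b\<le>s + 1 - a. green s a b) = smult (real s + 2) (P_hat (s + 1))"
proof -
  have "(\<Sum>a\<le>s + 1. \<Sum>b\<le>s + 1 - a. green s a b)
      = (\<Sum>a\<le>s + 1. Q_hat a * P_hat (s + 1 - a))"
    by (intro sum.cong refl, subst sum_green_above) auto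
  then show ?thesis using sum_Q_hat_P_hat[of "s + 1"] by (simp add: add.commute)
qed

text \<open>
  The half-angle formulas \<open>2 cos\<^sup>2 x = 1 + cos 2x\<close> and \<open>2 sin\<^sup>2 x = 1 - cos 2x\<close> linearise the diagonal
  entries. What is left is an even-indexed \<open>Q_hat\<close>, rewritten in terms of two consecutive
  \<open>P_hat\<close>: with the backward step in the first case, with the forward step in the second.
\<close>

lemma green_diag_lower:
  "2 * (W_poly ^ e * Q_hat (a + 1) * Q_hat (a + 1))
     = W_poly ^ e * P_hat (2 * (a + 1)) - W_poly ^ (e + 1) * (P_hat (2 * a + 1) - W_poly ^ a)"
proof -
  have "2 * Q_hat (a + 1) ^ 2 = Q_hat (2 * (a + 1)) + W_poly ^ (a + 1)"
    unfolding W_power_hat mult_2 hat_add by (simp add: power2_eq_square algebra_simps)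
  moreover have "Q_hat (2 * (a + 1)) = P_hat (2 * (a + 1)) - W_poly * P_hat (2 * a + 1)"
    using W_P_hat[of "2 * a + 1"] by (simp add: algebra_simps)
  ultimately have "2 * Q_hat (a + 1) ^ 2
      = P_hat (2 * (a + 1)) - W_poly * P_hat (2 * a + 1) + W_poly ^ (a + 1)" by simp
  then have "W_poly ^ e * (2 * Q_hat (a + 1) ^ 2)
      = W_poly ^ e * (P_hat (2 * (a + 1)) - W_poly * P_hat (2 * a + 1) + W_poly ^ (a + 1))"
    by simp
  then show ?thesis by (simp add: power_add power2_eq_square algebra_simps)
qed

lemma green_diag_upper:
  "2 * (Y_poly * P_hat k * P_hat k) = P_hat (2 * k) - (P_hat (2 * k + 1) - W_poly ^ k)"
  by (simp only: W_power_hat P_hat_Suc Suc_eq_plus1[symmetric] mult_2 hat_add)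
     (simp add: power2_eq_square algebra_simps)

lemma two_smult_half: "2 * smult (1/2) p = p" for p :: "real poly"
  by (simp add: numeral_poly)
text \<open>
  The two parity cases in the definition of \<open>R_poly\<close> are one formula, once the summands \<open>1\<close> are
  separated from the powers of \<open>W_poly\<close>.
\<close>

lemma two_R_poly:
  fixes s l :: nat
  assumes "l = s div 2"
  shows "2 * R_poly s
    = (\<Sum>r=1..l+1. W_poly ^ (s + 2 - 2 * r) * P_hat (2 * r))
      - (\<Sum>r=1..l. W_poly ^ (s + 1 - 2 * r) * (P_hat (2 * r + 1) - W_poly ^ r))
      + (\<Sum>r=1..s-l. P_hat (2 * r) - (P_hat (2 * r + 1) - W_poly ^ r))"
proof (cases "even s")
  case True
  then have s: "s = 2 * l" by (simp add: assms)
  have sl: "s - l = l" by (simp add: s)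
  have "2 * R_poly s
    = (\<Sum>r=1..l. (1 + W_poly ^ (s + 2 - 2 * r)) * P_hat (2 * r)) + P_hat (2 * l + 2)
      - (\<Sum>r=1..l. (1 + W_poly ^ (s + 1 - 2 * r)) * (P_hat (2 * r + 1) - W_poly ^ r))"
    using True unfolding R_poly_def Let_def assms[symmetric]
    by (simp only: if_True right_diff_distrib distrib_left two_smult_half s)
  then show ?thesis
    unfolding sl
    by (simp add: sum.distrib sum_subtractf distrib_right s)
next
  case False
  then have s: "s = 2 * l + 1" unfolding assms by presburger
  have sl: "s - l = l + 1" by (simp add: s)
  have e: "s + 2 = 2 * l + 3" "s + 1 = 2 * l + 2" by (simp_all add: s)
  have "2 * R_poly s
    = (\<Sum>r=1..l+1. (1 + W_poly ^ (s + 2 - 2 * r)) * P_hat (2 * r))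
      - (\<Sum>r=1..l. (1 + W_poly ^ (s + 1 - 2 * r)) * (P_hat (2 * r + 1) - W_poly ^ r))
      - (P_hat (2 * l + 3) - W_poly ^ (l + 1))"
    using False unfolding R_poly_def Let_def assms[symmetric] e
    by (simp only: if_False right_diff_distrib two_smult_half)
  moreover have "2 * (l + 1) + 1 = 2 * l + 3" by simp
  ultimately show ?thesis
    unfolding sl
    by (simp add: sum.distrib sum_subtractf distrib_right s numeral_3_eq_3)
qed

text \<open>
  The trace of \<open>G\<close>: in the factors \<open>1 + W ^ _\<close> of \<open>R_poly\<close>, the powers come from the diagonal
  entries in the first branch of \<open>green\<close> (\<open>2 a \<le> s\<close>), the summands 1 from those in the second.
\<close>

lemma sum_green_diag: "(\<Sum>a\<le>s. green s a a) = R_poly s"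
proof -
  define l where "l = s div 2"
  have l: "l \<le> s" "2 * l \<le> s" "s < 2 * (l + 1)" by (auto simp: l_def)
  have lower: "2 * (\<Sum>a\<le>l. green s a a)
      = (\<Sum>r=1..l+1. W_poly ^ (s + 2 - 2 * r) * P_hat (2 * r))
        - (\<Sum>r=1..l. W_poly ^ (s + 1 - 2 * r) * (P_hat (2 * r + 1) - W_poly ^ r))"
  proof -
    have "2 * (\<Sum>a\<le>l. green s a a)
        = (\<Sum>a\<le>l. W_poly ^ (s - 2 * a) * P_hat (2 * (a + 1))
             - W_poly ^ (s + 1 - 2 * a) * (P_hat (2 * a + 1) - W_poly ^ a))"
      unfolding sum_distrib_left
    proof (intro sum.cong refl)
      fix a assume "a \<in> {..l}"
      then have "a + a \<le> s" "s - a - a = s - 2 * a" "s + 1 - 2 * a = (s - 2 * a) + 1"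
        using l by auto
      then show "2 * green s a a = W_poly ^ (s - 2 * a) * P_hat (2 * (a + 1))
             - W_poly ^ (s + 1 - 2 * a) * (P_hat (2 * a + 1) - W_poly ^ a)"
        using green_diag_lower[of "s - 2 * a" a] by (simp only: green_def if_True)
    qed
    also have "\<dots> = (\<Sum>a\<le>l. W_poly ^ (s - 2 * a) * P_hat (2 * (a + 1)))
             - (\<Sum>a\<le>l. W_poly ^ (s + 1 - 2 * a) * (P_hat (2 * a + 1) - W_poly ^ a))"
      by (rule sum_subtractf)
    also have "(\<Sum>a\<le>l. W_poly ^ (s - 2 * a) * P_hat (2 * (a + 1)))
        = (\<Sum>r=1..l+1. W_poly ^ (s + 2 - 2 * r) * P_hat (2 * r))"
      by (rule sum.reindex_bij_witness[of _ "\<lambda>r. r - 1" Suc]) auto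
    also have "(\<Sum>a\<le>l. W_poly ^ (s + 1 - 2 * a) * (P_hat (2 * a + 1) - W_poly ^ a))
        = (\<Sum>r=1..l. W_poly ^ (s + 1 - 2 * r) * (P_hat (2 * r + 1) - W_poly ^ r))"
      by (rule sum.mono_neutral_right) (auto simp: P_hat_Suc not_le)
    finally show ?thesis .
  qed
  have upper: "2 * (\<Sum>a\<in>{l+1..s}. green s a a)
      = (\<Sum>r=1..s-l. P_hat (2 * r) - (P_hat (2 * r + 1) - W_poly ^ r))"
  proof -
    have "(\<Sum>a\<in>{l+1..s}. green s a a) = (\<Sum>r=1..s-l. Y_poly * P_hat r * P_hat r)"
      by (rule sum.reindex_bij_witness[of _ "\<lambda>r. s + 1 - r" "\<lambda>a. s + 1 - a"])
         (use l in \<open>auto simp: green_def\<close>)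
    then show ?thesis
      by (simp only: sum_distrib_left green_diag_upper)
  qed
  have "{..s} = {..l} \<union> {l+1..s}" using l by auto
  then have "(\<Sum>a\<le>s. green s a a) = (\<Sum>a\<le>l. green s a a) + (\<Sum>a\<in>{l+1..s}. green s a a)"
    by (simp only:) (rule sum.union_disjoint, auto)
  then have "2 * (\<Sum>a\<le>s. green s a a) = 2 * R_poly s"
    unfolding two_R_poly[OF l_def] using lower upper by (simp add: distrib_left)
  then show ?thesis by simp
qed

section \<open>Lattice points as walks\<close>

text \<open>
  Points of the zigzag polytope with prescribed ends, viewed as walks from \<open>a\<close> to \<open>b\<close>. The
  cyclic condition only involves the ends, so these numbers determine \<open>N_cyc\<close>.
\<close>

definition paths :: "nat \<Rightarrow> nat \<Rightarrow> nat \<Rightarrow> nat \<Rightarrow> (nat \<Rightarrow> real) set" where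
  "paths s d a b = {x \<in> zz_polytope s d \<inter> integer_points d. x 1 = real a \<and> x d = real b}"

lemma paths_1: "paths s 1 a b = (if a = b then {\<lambda>i\<in>{1..1}. real a} else {})"
  by (auto simp: paths_def zz_polytope_def integer_points_def PiE_iff extensional_def fun_eq_iff)

text \<open>
  The last coordinate can be split off; the only condition on it involves its predecessor \<open>c\<close>.
\<close>

lemma paths_Suc:
  assumes "d \<ge> 1"
  shows "paths s (Suc d) a b
       = (\<Union>c\<in>{c. c + b \<le> s + delta d}. (\<lambda>x. x(Suc d := real b)) ` paths s d a c)"
    (is "?L = ?R")
proof (intro equalityI subsetI)
  fix x assume x: "x \<in> ?L"
  define x' where "x' = x(Suc d := undefined)"
  have "x d \<in> \<int>" "x d \<ge> 0"
    using x assms by (auto simp: paths_def zz_polytope_def integer_points_def PiE_iff)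
  then obtain c where c: "x d = real c"
    by (metis Ints_cases of_int_0_le_iff of_nat_nat of_int_of_nat_eq)
  have b: "x (Suc d) = real b" using x by (simp add: paths_def)
  have "x d + x (d + 1) \<le> real (s + delta d)"
    using x assms unfolding paths_def zz_polytope_def by (auto dest!: bspec[of _ _ d])
  then have "real (c + b) \<le> real (s + delta d)" using b c by simp
  then have "c + b \<le> s + delta d" by (simp only: of_nat_le_iff)
  moreover have "x' \<in> paths s d a c"
    using x assms c
    by (auto simp: paths_def zz_polytope_def integer_points_def PiE_iff extensional_def x'_def)
  moreover have "x = x'(Suc d := real b)" using b by (auto simp: x'_def)
  ultimately show "x \<in> ?R" by blast
next
  fix x assume "x \<in> ?R"
  then obtain c x' where cb: "c + b \<le> s + delta d" and x': "x' \<in> paths s d a c"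
    and x: "x = x'(Suc d := real b)" by blast
  have "real c + real b \<le> real (s + delta d)" using cb by (simp flip: of_nat_add)
  then have "x i + x (i + 1) \<le> real (s + delta i)" if "i \<in> {1..Suc d - 1}" for i
    using that x' by (cases "i = d") (auto simp: x paths_def zz_polytope_def)
  then show "x \<in> ?L"
    using x' assms
    by (auto simp: paths_def zz_polytope_def integer_points_def PiE_iff extensional_def x)
qed

lemma finite_paths: "d \<ge> 1 \<Longrightarrow> finite (paths s d a b)"
proof (induction d arbitrary: b rule: dec_induct)
  case base
  then show ?case using paths_1[of s a b] by simp
next
  case (step d)
  have "finite {c. c + b \<le> s + delta d}" by (rule finite_subset[of _ "{..s + delta d}"]) auto
  then show ?case using step by (subst paths_Suc) auto
qed

lemma card_paths_Suc:
  assumes "d \<ge> 1"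
  shows "card (paths s (Suc d) a b) = (\<Sum>c | c + b \<le> s + delta d. card (paths s d a c))"
proof -
  have "finite {c. c + b \<le> s + delta d}" by (rule finite_subset[of _ "{..s + delta d}"]) auto
  moreover have "inj_on (\<lambda>x. x(Suc d := real b)) (paths s d a c)" for c
  proof (rule inj_onI)
    fix x y assume "x \<in> paths s d a c" "y \<in> paths s d a c" "x(Suc d := real b) = y(Suc d := real b)"
    moreover from this have "x (Suc d) = undefined" "y (Suc d) = undefined"
      by (auto simp: paths_def zz_polytope_def PiE_iff extensional_def)
    ultimately show "x = y" by (metis fun_upd_triv fun_upd_upd)
  qed
  moreover have "(\<lambda>x. x(Suc d := real b)) ` paths s d a c \<inter> (\<lambda>x. x(Suc d := real b)) ` paths s d a c' = {}"
    if "c \<noteq> c'" for c c'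
    using that by (auto simp: paths_def fun_eq_iff) (metis Suc_n_not_n of_nat_eq_iff)
  ultimately show ?thesis
    unfolding paths_Suc[OF assms]
    by (subst card_UN_disjoint) (auto simp: finite_paths[OF assms] card_image)
qed

lemma N_cyc_eq:
  assumes "d \<ge> 1"
  shows "N_cyc s d = (\<Sum>a\<le>s + delta d. \<Sum>b\<le>s + delta d - a. card (paths s d a b))"
proof -
  define A where "A = (SIGMA a:{..s + delta d}. {..s + delta d - a})"
  have A: "(a, b) \<in> A \<longleftrightarrow> a + b \<le> s + delta d" for a b by (auto simp: A_def)
  have fin: "finite A" by (auto simp: A_def)
  have disj: "a = a' \<and> b = b'" if "x \<in> paths s d a b" "x \<in> paths s d a' b'" for x a b a' b'
    using that by (simp add: paths_def)
  have "{x \<in> zz_polytope s d. x d + x 1 \<le> real (s + delta d)} \<inter> integer_points d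
      = (\<Union>(a, b)\<in>A. paths s d a b)" (is "?L = ?R")
  proof (intro equalityI subsetI)
    fix x assume x: "x \<in> ?L"
    then have "x 1 \<in> \<int>" "x 1 \<ge> 0" "x d \<in> \<int>" "x d \<ge> 0"
      using assms by (auto simp: zz_polytope_def integer_points_def PiE_iff)
    then obtain a b where ab: "x 1 = real a" "x d = real b"
      by (metis Ints_cases of_int_0_le_iff of_nat_nat of_int_of_nat_eq)
    have "real (b + a) \<le> real (s + delta d)" using x ab by simp
    then have "(a, b) \<in> A" unfolding A of_nat_le_iff by simp
    then show "x \<in> ?R" using x ab by (auto simp: paths_def)
  next
    fix x assume "x \<in> ?R"
    then obtain a b where ab: "a + b \<le> s + delta d" "x \<in> paths s d a b" by (auto simp: A)
    have "real b + real a \<le> real (s + delta d)" using ab(1) by (simp flip: of_nat_add)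
    then show "x \<in> ?L" using ab(2) by (auto simp: paths_def)
  qed
  then have "N_cyc s d = card (\<Union>(a, b)\<in>A. paths s d a b)" by (simp add: N_cyc_def)
  also have "\<dots> = (\<Sum>(a, b)\<in>A. card (paths s d a b))"
    using fin
    by (subst card_UN_disjoint) (auto simp: finite_paths[OF assms] case_prod_unfold dest: disj)
  finally show ?thesis by (simp add: A_def sum.Sigma)
qed

lemma card_paths_2: "card (paths s 2 a b) = (if a + b \<le> s then 1 else 0)"
proof -
  have "finite {c. c + b \<le> s}" by (rule finite_subset[of _ "{..s}"]) auto
  moreover have "card (paths s 2 a b) = (\<Sum>c | c + b \<le> s. if a = c then 1 else 0)"
    using card_paths_Suc[of 1 s a b] by (simp add: paths_1[simplified] delta_def numeral_2_eq_2 if_distrib cong: if_cong)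
  ultimately show ?thesis by simp
qed

lemma card_paths_odd_step:
  assumes "odd d"
  shows "card (paths s (Suc d) a b) = (if b \<le> s then \<Sum>c\<le>s - b. card (paths s d a c) else 0)"
proof -
  have d: "d \<ge> 1" using odd_pos[OF assms] by simp
  have "{c. c + b \<le> s} = (if b \<le> s then {..s - b} else {})" by auto
  then show ?thesis using card_paths_Suc[OF d, of s a b] assms by (simp add: delta_def)
qed

lemma card_paths_even_step:
  assumes "d \<ge> 1" "even d" "c \<le> s + 1"
  shows "card (paths s (Suc d) a c) = (\<Sum>b\<le>s + 1 - c. card (paths s d a b))"
proof -
  have "{b. b + c \<le> s + 1} = {..s + 1 - c}" using assms(3) by auto
  then show ?thesis using card_paths_Suc[OF assms(1), of s a c] assms(2) by (simp add: delta_def)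
qed

lemma card_paths_Suc_Suc:
  assumes "b \<le> s"
  shows "card (paths s (2 * (m + 1) + 2) a b)
       = (\<Sum>c\<le>s - b. \<Sum>b'\<le>s + 1 - c. card (paths s (2 * (m + 1)) a b'))"
proof -
  have "card (paths s (2 * (m + 1) + 2) a b) = (\<Sum>c\<le>s - b. card (paths s (2 * (m + 1) + 1) a c))"
    using card_paths_odd_step[of "2 * (m + 1) + 1" s a b] assms by simp
  also have "\<dots> = (\<Sum>c\<le>s - b. \<Sum>b'\<le>s + 1 - c. card (paths s (2 * (m + 1)) a b'))"
    by (intro sum.cong refl) (use card_paths_even_step[of "2 * (m + 1)"] in simp)
  finally show ?thesis .
qed

lemma N_cyc_even:
  "N_cyc s (2 * (m + 1)) = (\<Sum>a\<le>s + 1. \<Sum>b\<le>s + 1 - a. card (paths s (2 * (m + 1)) a b))"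
  by (subst N_cyc_eq) (simp_all add: delta_def)

text \<open>
  In odd dimension the closing condition is the same as that of one further step that returns to
  the start.
\<close>

lemma N_cyc_odd:
  "N_cyc s (2 * m + 1) = (\<Sum>a\<le>s. card (paths s (2 * (m + 1)) a a))"
proof -
  have "N_cyc s (2 * m + 1) = (\<Sum>a\<le>s. \<Sum>b\<le>s - a. card (paths s (2 * m + 1) a b))"
    by (subst N_cyc_eq) (simp_all add: delta_def)
  also have "\<dots> = (\<Sum>a\<le>s. card (paths s (2 * (m + 1)) a a))"
    by (intro sum.cong refl) (simp add: card_paths_odd_step)
  finally show ?thesis .
qed

section \<open>The generating functions\<close>

definition walk_fps :: "nat \<Rightarrow> nat \<Rightarrow> nat \<Rightarrow> real fps" where
  "walk_fps s a b = Abs_fps (\<lambda>m. real (card (paths s (2 * (m + 1)) a b)))"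

lemma coeff_Q_hat: "coeff (Q_hat n) k = (- 1) ^ k * real (n choose (2 * k))"
  by (simp add: Q_hat_def coeff_pcompose_linear coeff_Q_poly)

lemma fps_of_poly_Y_poly: "fps_of_poly Y_poly = fps_X"
  by (simp add: Y_poly_def)

text \<open>
  The walk numbers satisfy the resolvent equation, and that equation determines the coefficients
  one after the other, so its explicit solution is the generating function. Division by the
  denominator is possible because its constant coefficient is 1.
\<close>

lemma walk_fps_eq_green:
  assumes "a \<le> s + 1" "b \<le> s + 1"
  shows "fps_of_poly (Q_hat (s + 2)) * walk_fps s a b = fps_of_poly (green s a b)"
proof -
  define q where "q = fps_of_poly (Q_hat (s + 2))"
  define G where "G b = inverse q * fps_of_poly (green s a b)" for b
  have q0: "fps_nth q 0 = 1" by (simp add: q_def coeff_Q_hat)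
  then have qq: "inverse q * q = 1" by (intro inverse_mult_eq_1) simp
  have G_eq: "G b = (if a + b \<le> s then 1 else 0)
                      + fps_X * (\<Sum>c\<le>s - b. \<Sum>b'\<le>s + 1 - c. G b')" if "b \<le> s" for b
  proof -
    have "G b = inverse q * ((if a + b \<le> s then q else 0)
        + fps_X * (\<Sum>c\<le>s - b. \<Sum>b'\<le>s + 1 - c. fps_of_poly (green s a b')))"
      unfolding G_def green_eq[OF assms(1) that]
      by (simp add: fps_of_poly_add fps_of_poly_mult fps_of_poly_sum q_def fps_of_poly_Y_poly)
    then show ?thesis
      using qq by (auto simp: G_def sum_distrib_left algebra_simps)
  qed
  have G_last: "G (s + 1) = 0" by (simp add: G_def green_def)
  have "fps_nth (G b) m = real (card (paths s (2 * (m + 1)) a b))" if "b \<le> s + 1" for b m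
    using that
  proof (induction m arbitrary: b)
    case 0
    show ?case
    proof (cases "b \<le> s")
      case True
      then show ?thesis using G_eq[OF True] card_paths_2[of s a b] by simp
    next
      case False
      then show ?thesis using 0 G_last card_paths_2[of s a b] by (simp add: le_Suc_eq)
    qed
  next
    case (Suc m)
    show ?case
    proof (cases "b \<le> s")
      case True
      have "fps_nth (G b) (Suc m) = (\<Sum>c\<le>s - b. \<Sum>b'\<le>s + 1 - c. fps_nth (G b') m)"
        by (subst G_eq[OF True]) (simp add: fps_sum_nth)
      also have "\<dots> = (\<Sum>c\<le>s - b. \<Sum>b'\<le>s + 1 - c. real (card (paths s (2 * (m + 1)) a b')))"
        by (intro sum.cong refl Suc.IH) auto
      finally show ?thesis using card_paths_Suc_Suc[OF True, of m a] by simp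
    next
      case False
      then show ?thesis
        using Suc.prems G_last card_paths_odd_step[of "2 * (m + 1) + 1" s a b]
        by (simp add: le_Suc_eq)
    qed
  qed
  then have "walk_fps s a b = G b" using assms by (simp add: walk_fps_def fps_eq_iff)
  moreover have "q * G b = (inverse q * q) * fps_of_poly (green s a b)"
    by (simp only: G_def mult_ac)
  ultimately show ?thesis unfolding qq q_def[symmetric] by (simp only: mult_1)
qed

lemma Psi_cyc_mult:
  "fps_of_poly (smult 2 (Q_hat (s + 2))) * Psi_cyc s
     = fps_of_poly (smult (real s + 2) (P_hat (s + 1)))"
proof -
  have "Psi_cyc s = (\<Sum>a\<le>s + 1. \<Sum>b\<le>s + 1 - a. walk_fps s a b)"
    by (simp only: Psi_cyc_def fps_eq_iff walk_fps_def fps_sum_nth fps_nth_Abs_fps N_cyc_even of_nat_sum) simp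
  then have "fps_of_poly (Q_hat (s + 2)) * Psi_cyc s
      = (\<Sum>a\<le>s + 1. \<Sum>b\<le>s + 1 - a. fps_of_poly (Q_hat (s + 2)) * walk_fps s a b)"
    by (simp only: sum_distrib_left)
  also have "\<dots> = fps_of_poly (\<Sum>a\<le>s + 1. \<Sum>b\<le>s + 1 - a. green s a b)"
    unfolding fps_of_poly_sum by (intro sum.cong refl walk_fps_eq_green) auto
  finally have "2 * (fps_of_poly (Q_hat (s + 2)) * Psi_cyc s)
      = fps_of_poly (2 * (\<Sum>a\<le>s + 1. \<Sum>b\<le>s + 1 - a. green s a b))"
    by (simp only: fps_of_poly_mult fps_of_poly_numeral)
  then show ?thesis
    unfolding sum_green_even by (simp add: fps_of_poly_smult mult.assoc flip: fps_numeral_fps_const)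
qed

text \<open>
  The series here starts in dimension 1, one term before \<open>Omega_cyc\<close>; this term is what the
  multiple of \<open>Q_hat (s + 2)\<close> in the formula for \<open>Omega_cyc\<close> removes.
\<close>

lemma trace_fps_mult:
  "fps_of_poly (Q_hat (s + 2)) * Abs_fps (\<lambda>m. real (N_cyc s (2 * m + 1))) = fps_of_poly (R_poly s)"
proof -
  have "Abs_fps (\<lambda>m. real (N_cyc s (2 * m + 1))) = (\<Sum>a\<le>s. walk_fps s a a)"
    by (simp only: fps_eq_iff walk_fps_def fps_sum_nth fps_nth_Abs_fps N_cyc_odd of_nat_sum) simp
  then have "fps_of_poly (Q_hat (s + 2)) * Abs_fps (\<lambda>m. real (N_cyc s (2 * m + 1)))
      = (\<Sum>a\<le>s. fps_of_poly (Q_hat (s + 2)) * walk_fps s a a)"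
    by (simp only: sum_distrib_left)
  also have "\<dots> = fps_of_poly (\<Sum>a\<le>s. green s a a)"
    unfolding fps_of_poly_sum by (intro sum.cong refl walk_fps_eq_green) auto
  finally show ?thesis by (simp only: sum_green_diag)
qed

lemma N_cyc_1: "N_cyc s 1 = s div 2 + 1"
proof -
  have "N_cyc s 1 = (\<Sum>a\<le>s. card (paths s 2 a a))"
    using N_cyc_odd[of s 0] by simp
  also have "\<dots> = (\<Sum>a\<in>{..s div 2}. 1)"
    by (rule sum.mono_neutral_cong_right) (auto simp: card_paths_2)
  finally show ?thesis by simp
qed

lemma Omega_cyc_mult:
  "fps_X * fps_of_poly (Q_hat (s + 2)) * Omega_cyc s
     = fps_of_poly (R_poly s - smult (real (s div 2) + 1) (Q_hat (s + 2)))"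
proof -
  have "Abs_fps (\<lambda>m. real (N_cyc s (2 * m + 1))) = fps_const (real (s div 2) + 1) + fps_X * Omega_cyc s"
  proof (rule fps_ext)
    fix m show "fps_nth (Abs_fps (\<lambda>m. real (N_cyc s (2 * m + 1)))) m
      = fps_nth (fps_const (real (s div 2) + 1) + fps_X * Omega_cyc s) m"
      using N_cyc_1[of s] by (cases m) (simp_all add: Omega_cyc_def)
  qed
  then show ?thesis
    using trace_fps_mult[of s] by (simp add: fps_of_poly_diff fps_of_poly_smult algebra_simps)
qed

section \<open>Coefficients of a rational series with a dominant simple pole\<close>

text \<open>
  Dividing a power series by \<open>1 - y / z\<close> convolves it with a geometric series, so absolute
  convergence at a radius \<open>r < z\<close> is preserved and the value there is divided by \<open>1 - r / z\<close>.
\<close>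

lemma geometric_factor_sums:
  fixes g h :: "real fps"
  assumes g: "g * fps_of_poly [:1, - (1 / z):] = h" and r: "0 < r" "r < z"
    and summ: "summable (\<lambda>n. \<bar>fps_nth h n * r ^ n\<bar>)"
    and sums: "(\<lambda>n. fps_nth h n * r ^ n) sums v"
  shows "summable (\<lambda>n. \<bar>fps_nth g n * r ^ n\<bar>)"
    and "(\<lambda>n. fps_nth g n * r ^ n) sums (v / (1 - r / z))"
proof -
  have z: "\<bar>r / z\<bar> < 1" using r by simp
  define e :: "real fps" where "e = Abs_fps (\<lambda>n. (1 / z) ^ n)"
  have e_sums: "(\<lambda>n. fps_nth e n * r ^ n) sums (1 / (1 - r / z))"
    using geometric_sums[of "r / z"] z by (simp add: e_def power_divide)
  have e_summ: "summable (\<lambda>n. \<bar>fps_nth e n * r ^ n\<bar>)"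
    using summable_geometric[of "r / z"] z r
    by (simp add: e_def power_divide abs_mult power_abs)
  have "e * fps_of_poly [:1, - (1 / z):] = 1"
  proof (rule fps_ext)
    fix n show "fps_nth (e * fps_of_poly [:1, - (1 / z):]) n = fps_nth 1 n"
      by (cases n) (simp_all add: fps_of_poly_linear' e_def distrib_left mult.assoc[symmetric])
  qed
  then have g_eq: "g = h * e"
    using g by (metis mult.assoc mult.commute mult_1)
  have conv: "fps_nth g n * r ^ n = (\<Sum>i\<le>n. (fps_nth h i * r ^ i) * (fps_nth e (n - i) * r ^ (n - i)))" for n
  proof -
    have "fps_nth h i * fps_nth e (n - i) * r ^ n
        = (fps_nth h i * r ^ i) * (fps_nth e (n - i) * r ^ (n - i))" if "i \<le> n" for i
    proof -
      have "r ^ n = r ^ i * r ^ (n - i)" using that by (simp flip: power_add)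
      then show ?thesis by (simp add: mult_ac)
    qed
    then show ?thesis
      unfolding g_eq fps_mult_nth atLeast0AtMost sum_distrib_right
      by (intro sum.cong refl) (meson atMost_iff)
  qed
  show "summable (\<lambda>n. \<bar>fps_nth g n * r ^ n\<bar>)"
  proof (rule summable_comparison_test')
    show "summable (\<lambda>n. \<Sum>i\<le>n. \<bar>fps_nth h i * r ^ i\<bar> * \<bar>fps_nth e (n - i) * r ^ (n - i)\<bar>)"
      using summable_Cauchy_product[of "\<lambda>n. \<bar>fps_nth h n * r ^ n\<bar>" "\<lambda>n. \<bar>fps_nth e n * r ^ n\<bar>"]
        summ e_summ by simp
    show "norm \<bar>fps_nth g n * r ^ n\<bar>
        \<le> (\<Sum>i\<le>n. \<bar>fps_nth h i * r ^ i\<bar> * \<bar>fps_nth e (n - i) * r ^ (n - i)\<bar>)" for n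
      unfolding conv real_norm_def abs_idempotent abs_mult[of "fps_nth h _ * _", symmetric] by (rule sum_abs)
  qed
  show "(\<lambda>n. fps_nth g n * r ^ n) sums (v / (1 - r / z))"
    using Cauchy_product_sums[of "\<lambda>n. fps_nth h n * r ^ n" "\<lambda>n. fps_nth e n * r ^ n"]
      summ e_summ
    unfolding conv sums_unique[OF sums, symmetric] sums_unique[OF e_sums, symmetric] by simp
qed

lemma quotient_at_inside_pole_sums:
  fixes g :: "real fps" and f :: "real poly"
  assumes "finite Z" "0 < r" "\<And>z. z \<in> Z \<Longrightarrow> r < z"
    and "g * fps_of_poly (\<Prod>z\<in>Z. [:1, - (1 / z):]) = fps_of_poly f"
  shows "summable (\<lambda>n. \<bar>fps_nth g n * r ^ n\<bar>)
       \<and> (\<lambda>n. fps_nth g n * r ^ n) sums (poly f r / (\<Prod>z\<in>Z. 1 - r / z))"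
  using assms
proof (induction Z arbitrary: g rule: finite_induct)
  case empty
  then have "g = fps_of_poly f" by simp
  then have g: "fps_nth g n = coeff f n" for n by simp
  have "(\<lambda>n. fps_nth g n * r ^ n) sums (\<Sum>n\<le>degree f. fps_nth g n * r ^ n)"
    by (rule sums_finite) (auto simp: g coeff_eq_0)
  moreover have "summable (\<lambda>n. \<bar>fps_nth g n * r ^ n\<bar>)"
    by (rule summable_finite[of "{..degree f}"]) (auto simp: g coeff_eq_0)
  ultimately show ?case by (simp add: g poly_altdef)
next
  case (insert z Z)
  define h where "h = g * fps_of_poly [:1, - (1 / z):]"
  have "h * fps_of_poly (\<Prod>z\<in>Z. [:1, - (1 / z):]) = fps_of_poly f"
    using insert.prems(3)
    by (simp only: h_def fps_of_poly_mult mult.assoc prod.insert[OF insert.hyps])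
  with insert have h: "summable (\<lambda>n. \<bar>fps_nth h n * r ^ n\<bar>)"
    "(\<lambda>n. fps_nth h n * r ^ n) sums (poly f r / (\<Prod>z\<in>Z. 1 - r / z))" by auto
  have z: "r < z" using insert by simp
  show ?case
    using geometric_factor_sums[OF h_def[symmetric] \<open>0 < r\<close> z h] insert.hyps
    by (simp add: mult.commute)
qed

text \<open>
  After all other poles are absorbed into a series that converges at \<open>r\<close>, division by the
  remaining factor \<open>1 - y / r\<close> forms partial sums: the normalised coefficients of the quotient
  are the partial sums of that series at \<open>r\<close>.
\<close>

lemma simple_dominant_pole:
  fixes F :: "real fps" and f :: "real poly"
  assumes Z: "finite Z" "\<And>z. z \<in> Z \<Longrightarrow> r < z" and r: "0 < r"
    and F: "fps_of_poly ([:1, - (1 / r):] * (\<Prod>z\<in>Z. [:1, - (1 / z):])) * F = fps_of_poly f"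
  shows "(\<lambda>n. fps_nth F n * r ^ n) \<longlonglongrightarrow> poly f r / (\<Prod>z\<in>Z. 1 - r / z)"
proof -
  define h where "h = F * fps_of_poly [:1, - (1 / r):]"
  have "h * fps_of_poly (\<Prod>z\<in>Z. [:1, - (1 / z):]) = fps_of_poly f"
    using F by (simp only: h_def fps_of_poly_mult mult_ac)
  from quotient_at_inside_pole_sums[OF Z(1) r Z(2) this]
  have "(\<lambda>n. fps_nth h n * r ^ n) sums (poly f r / (\<Prod>z\<in>Z. 1 - r / z))" by simp
  then have "(\<lambda>n. \<Sum>i\<le>n. fps_nth h i * r ^ i) \<longlonglongrightarrow> poly f r / (\<Prod>z\<in>Z. 1 - r / z)"
    by (simp add: sums_def_le)
  moreover have "(\<Sum>i\<le>n. fps_nth h i * r ^ i) = fps_nth F n * r ^ n" for n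
  proof (induction n)
    case 0
    then show ?case by (simp add: h_def fps_of_poly_linear')
  next
    case (Suc n)
    have "fps_nth h (Suc n) = fps_nth F (Suc n) - fps_nth F n / r"
      by (simp add: h_def fps_of_poly_linear' distrib_left mult.assoc[symmetric])
    then have "fps_nth h (Suc n) * r = fps_nth F (Suc n) * r - fps_nth F n"
      using r by (simp add: field_simps)
    then have "(fps_nth h (Suc n) * r) * r ^ n = (fps_nth F (Suc n) * r - fps_nth F n) * r ^ n"
      by (simp only:)
    then show ?case using Suc by (simp add: algebra_simps)
  qed
  ultimately show ?thesis by simp
qed

section \<open>The zeros of the denominator\<close>

lemma hat_poly_tan:
  assumes "cos t \<noteq> 0"
  shows "poly (Q_hat n) ((tan t)\<^sup>2) * cos t ^ n = cos (real n * t)"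
    and "poly (P_hat n) ((tan t)\<^sup>2) * tan t * cos t ^ n = sin (real n * t)"
proof (induction n)
  case (Suc n)
  have tc: "tan t * cos t = sin t" using assms by (simp add: tan_def)
  have n: "real (Suc n) * t = real n * t + t" by (simp add: algebra_simps)
  {
    case 1
    have "poly (Q_hat (Suc n)) ((tan t)\<^sup>2) * cos t ^ Suc n
        = (poly (Q_hat n) ((tan t)\<^sup>2) * cos t ^ n) * cos t
          - (poly (P_hat n) ((tan t)\<^sup>2) * tan t * cos t ^ n) * (tan t * cos t)"
      by (simp add: Q_hat_Suc Y_poly_def power2_eq_square algebra_simps)
    then show ?case unfolding Suc tc n cos_add by simp
  next
    case 2
    have "poly (P_hat (Suc n)) ((tan t)\<^sup>2) * tan t * cos t ^ Suc n
        = (poly (P_hat n) ((tan t)\<^sup>2) * tan t * cos t ^ n) * cos t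
          + (poly (Q_hat n) ((tan t)\<^sup>2) * cos t ^ n) * (tan t * cos t)"
      by (simp add: P_hat_Suc algebra_simps)
    then show ?case unfolding Suc tc n sin_add by simp
  }
qed simp_all

text \<open>
  Together with \<open>sum_green_even\<close> this says that \<open>Psi_cyc\<close> is the negative logarithmic derivative of
  its denominator, as it must be for a generating function of traces of powers. It is the
  reason why the leading constant in even dimension is 1.
\<close>

lemma pderiv_Q_hat: "2 * pderiv (Q_hat (Suc n)) = - smult (real (Suc n)) (P_hat n)"
proof (rule poly_eqI)
  fix k
  have "2 * real (Suc k) * real (Suc n choose (2 * Suc k)) = real (Suc (Suc (2 * k)) * (Suc n choose (Suc (Suc (2 * k)))))"
    by (simp add: algebra_simps del: binomial_Suc_Suc)
  also have "\<dots> = real (Suc n) * real (n choose (2 * k + 1))"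
    unfolding Suc_times_binomial by (simp only: of_nat_mult Suc_eq_plus1)
  finally have *: "2 * real (Suc k) * real (Suc n choose (2 * Suc k)) = real (Suc n) * real (n choose (2 * k + 1))" .
  have "coeff (2 * pderiv (Q_hat (Suc n))) k
      = - ((- 1) ^ k * (2 * real (Suc k) * real (Suc n choose (2 * Suc k))))"
    by (simp add: numeral_poly coeff_pderiv coeff_Q_hat algebra_simps del: binomial_Suc_Suc)
  also have "\<dots> = coeff (- smult (real (Suc n)) (P_hat n)) k"
    unfolding * by (simp add: P_hat_def coeff_pcompose_linear coeff_P_poly algebra_simps)
  finally show "coeff (2 * pderiv (Q_hat (Suc n))) k = coeff (- smult (real (Suc n)) (P_hat n)) k" .
qed

text \<open>
  The zeros of \<open>Q_hat (s + 2)\<close>, which is \<open>cos ((s + 2) \<theta>) / cos \<theta> ^ (s + 2)\<close> at \<open>tan\<^sup>2 \<theta>\<close>.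
\<close>

definition pole :: "nat \<Rightarrow> nat \<Rightarrow> real" where
  "pole s k = (tan (real (2 * k + 1) * alpha s))\<^sup>2"

lemma pole_0: "pole s 0 = y_star s"
  by (simp add: pole_def y_star_def)

lemma pole_angle_bounds:
  assumes "k \<le> s div 2"
  shows "0 < real (2 * k + 1) * alpha s" "real (2 * k + 1) * alpha s < pi / 2"
proof -
  show "0 < real (2 * k + 1) * alpha s" by (simp add: alpha_def)
  have "real (2 * k + 1) < real s + 2" using assms by linarith
  then have "real (2 * k + 1) / (real s + 2) < 1" by simp
  then have "real (2 * k + 1) / (real s + 2) * (pi / 2) < 1 * (pi / 2)"
    by (rule mult_strict_right_mono) simp
  moreover have "real (2 * k + 1) * alpha s = real (2 * k + 1) / (real s + 2) * (pi / 2)"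
    by (simp add: alpha_def field_simps)
  ultimately show "real (2 * k + 1) * alpha s < pi / 2" by (simp only: mult_1)
qed

lemma pole_pos: "k \<le> s div 2 \<Longrightarrow> 0 < pole s k"
  unfolding pole_def by (intro zero_less_power tan_gt_zero pole_angle_bounds)

lemma pole_less:
  assumes "j < k" "k \<le> s div 2"
  shows "pole s j < pole s k"
proof -
  have "real (2 * j + 1) * alpha s < real (2 * k + 1) * alpha s"
    using assms by (intro mult_strict_right_mono) (simp_all add: alpha_def)
  moreover have "j \<le> s div 2" using assms by simp
  ultimately have "tan (real (2 * j + 1) * alpha s) < tan (real (2 * k + 1) * alpha s)"
    using pole_angle_bounds[of j s] pole_angle_bounds[of k s] assms
    by (intro tan_monotone) auto
  moreover have "0 < tan (real (2 * j + 1) * alpha s)"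
    by (intro tan_gt_zero pole_angle_bounds \<open>j \<le> s div 2\<close>)
  ultimately show ?thesis
    unfolding pole_def by (intro power_strict_mono less_imp_le) simp_all
qed

lemma Q_hat_pole:
  assumes "k \<le> s div 2"
  shows "poly (Q_hat (s + 2)) (pole s k) = 0"
proof -
  define t where "t = real (2 * k + 1) * alpha s"
  have c: "cos t > 0" using pole_angle_bounds[OF assms] unfolding t_def by (intro cos_gt_zero) auto
  have "real (s + 2) * t = real (2 * k + 1) * (pi / 2)"
    by (simp add: t_def alpha_def field_simps)
  then have "cos (real (s + 2) * t) = 0"
    unfolding cos_zero_iff by (intro disjI1 exI[of _ "2 * k + 1"]) auto
  then show ?thesis using hat_poly_tan(1)[of t "s + 2"] c by (simp add: pole_def t_def)
qed

text \<open>
  The degree is at most the number of known zeros; the point 0, where both sides are 1, fixes the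
  constant factor.
\<close>

lemma Q_hat_factor:
  "Q_hat (s + 2) = (\<Prod>k\<le>s div 2. [:1, - (1 / pole s k):])"
proof (rule poly_eqI_degree[where A = "insert 0 (pole s ` {..s div 2})"])
  have inj: "inj_on (pole s) {..s div 2}"
    by (rule linorder_inj_onI) (use pole_less[of _ _ s] in force)+
  have "0 \<notin> pole s ` {..s div 2}" using pole_pos[of _ s] by force
  then have card: "card (insert 0 (pole s ` {..s div 2})) = s div 2 + 2"
    by (simp add: card_image[OF inj])
  have "degree (Q_hat (s + 2)) \<le> s div 2 + 1"
  proof (rule degree_le, intro allI impI)
    fix i assume "s div 2 + 1 < i"
    then have "s + 2 < 2 * i" by linarith
    then show "coeff (Q_hat (s + 2)) i = 0" by (simp add: coeff_Q_hat binomial_eq_0)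
  qed
  then show "degree (Q_hat (s + 2)) < card (insert 0 (pole s ` {..s div 2}))"
    using card by simp
  have "degree [:1, - c:] \<le> 1" for c :: real by simp
  then have "degree (\<Prod>k\<le>s div 2. [:1, - (1 / pole s k):]) \<le> (\<Sum>k\<le>s div 2. 1)"
    by (intro order.trans[OF degree_prod_sum_le] sum_mono) (simp_all add: o_def del: degree_pCons_eq_if)
  then show "degree (\<Prod>k\<le>s div 2. [:1, - (1 / pole s k):]) < card (insert 0 (pole s ` {..s div 2}))"
    using card by simp
  fix x assume x: "x \<in> insert 0 (pole s ` {..s div 2})"
  show "poly (Q_hat (s + 2)) x = poly (\<Prod>k\<le>s div 2. [:1, - (1 / pole s k):]) x"
  proof (cases "x = 0")
    case True
    then show ?thesis
      using coeff_Q_hat[of "s + 2" 0] by (simp add: poly_prod flip: poly_0_coeff_0)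
  next
    case False
    then obtain k where k: "k \<le> s div 2" "x = pole s k" using x by auto
    then have "poly (\<Prod>k\<le>s div 2. [:1, - (1 / pole s k):]) x = 0"
      using pole_pos[of k s] by (auto simp: poly_prod intro!: bexI[of _ k])
    then show ?thesis using Q_hat_pole k by simp
  qed
qed

section \<open>The asymptotics\<close>

text \<open>
  The product over the other poles in \<open>simple_dominant_pole\<close> is the derivative of the denominator
  at \<open>y_star s\<close>, up to the factor \<open>- y_star s\<close>, and the derivative is a multiple of \<open>P_hat (s + 1)\<close>.
\<close>

lemma coefficient_limit:
  fixes F :: "real fps" and f :: "real poly"
  assumes F: "fps_of_poly (Q_hat (s + 2)) * F = fps_of_poly f"
  shows "(\<lambda>n. fps_nth F n * y_star s ^ n)
           \<longlonglongrightarrow> 2 * poly f (y_star s) / ((real s + 2) * y_star s * poly (P_hat (s + 1)) (y_star s))"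
proof -
  define Z where "Z = pole s ` {1..s div 2}"
  define q where "q = (\<Prod>z\<in>Z. [:1, - (1 / z):])"
  have y: "0 < y_star s" using pole_pos[of 0 s] by (simp add: pole_0)
  have Z: "finite Z" "\<And>z. z \<in> Z \<Longrightarrow> y_star s < z"
    using pole_less[of 0 _ s] by (auto simp: Z_def pole_0)
  have inj: "inj_on (pole s) {1..s div 2}"
    by (rule linorder_inj_onI) (use pole_less[of _ _ s] in force)+
  have "Q_hat (s + 2) = (\<Prod>k\<in>insert 0 {1..s div 2}. [:1, - (1 / pole s k):])"
    unfolding Q_hat_factor by (rule prod.cong) auto
  also have "\<dots> = [:1, - (1 / pole s 0):] * (\<Prod>k\<in>{1..s div 2}. [:1, - (1 / pole s k):])"
    by (rule prod.insert) auto
  finally have Q: "Q_hat (s + 2) = [:1, - (1 / y_star s):] * q"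
    by (simp only: q_def Z_def prod.reindex[OF inj] pole_0 o_def)
  have "pderiv (Q_hat (s + 2)) = [:1, - (1 / y_star s):] * pderiv q + q * [:- (1 / y_star s):]"
    unfolding Q pderiv_mult by (simp add: pderiv_pCons)
  then have "poly (pderiv (Q_hat (s + 2))) (y_star s) = - poly q (y_star s) / y_star s"
    using y by simp
  moreover have "2 * poly (pderiv (Q_hat (s + 2))) (y_star s)
      = - (real s + 2) * poly (P_hat (s + 1)) (y_star s)"
    using arg_cong[OF pderiv_Q_hat[of "s + 1"], of "\<lambda>p. poly p (y_star s)"] by (simp add: algebra_simps)
  moreover have "poly q (y_star s) = - y_star s * (- poly q (y_star s) / y_star s)"
    using y by simp
  ultimately have "2 * poly q (y_star s) = - y_star s * (- (real s + 2) * poly (P_hat (s + 1)) (y_star s))"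
    by (metis mult.left_commute)
  then have "2 * poly q (y_star s) = (real s + 2) * y_star s * poly (P_hat (s + 1)) (y_star s)"
    by (simp only: minus_mult_left[symmetric] minus_mult_right[symmetric] minus_minus mult_ac)
  moreover have "poly q (y_star s) = (\<Prod>z\<in>Z. 1 - y_star s / z)"
    by (simp add: q_def poly_prod)
  ultimately have "poly f (y_star s) / (\<Prod>z\<in>Z. 1 - y_star s / z)
      = 2 * poly f (y_star s) / ((real s + 2) * y_star s * poly (P_hat (s + 1)) (y_star s))"
    by (metis mult_divide_mult_cancel_left_if zero_neq_numeral)
  then show ?thesis
    using simple_dominant_pole[OF Z y, of F f] F by (simp only: Q q_def)
qed

text \<open>
  At this angle \<open>(s + 1) \<alpha> = \<pi>/2 - \<alpha>\<close>, so the sine in the numerator is \<open>cos \<alpha>\<close>.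
\<close>

lemma P_hat_y_star:
  assumes "s \<ge> 1"
  shows "sin (alpha s) > 0" "cos (alpha s) > 0"
    and "poly (P_hat (s + 1)) (y_star s) = 1 / (sin (alpha s) * cos (alpha s) ^ (s - 1))"
proof -
  define t where "t = alpha s"
  have "0 < t" "t < pi / 2" using pole_angle_bounds[of 0 s] by (auto simp: t_def)
  then show sc: "sin (alpha s) > 0" "cos (alpha s) > 0"
    unfolding t_def by (auto intro!: sin_gt_zero cos_gt_zero)
  have "real (s + 2) * t = pi / 2" by (simp add: t_def alpha_def field_simps)
  then have "real (s + 1) * t = pi / 2 - t" by (simp add: algebra_simps)
  then have "poly (P_hat (s + 1)) (y_star s) * tan t * cos t ^ (s + 1) = cos t"
    using hat_poly_tan(2)[of t "s + 1"] sc by (simp add: y_star_def t_def sin_diff)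
  moreover have "tan t * cos t ^ (s + 1) = sin t * cos t ^ (s - 1) * cos t"
    using sc assms by (cases s) (simp_all add: tan_def t_def)
  ultimately have "poly (P_hat (s + 1)) (y_star s) * (sin t * cos t ^ (s - 1)) = 1"
    using sc by (simp add: t_def mult.assoc)
  then show "poly (P_hat (s + 1)) (y_star s) = 1 / (sin (alpha s) * cos (alpha s) ^ (s - 1))"
    using sc by (simp add: t_def field_simps)
qed

text \<open>
  As the trace of \<open>green\<close>, \<open>R_poly\<close> is a sum of squares weighted by \<open>y\<close> and powers of \<open>1 + y\<close>, and
  the entry at \<open>a = 0\<close> is such a power. This excludes that the odd leading constant vanishes.
\<close>

lemma R_poly_pos:
  assumes "y > 0"
  shows "poly (R_poly s) y > 0"
proof -
  have "poly (green s a a) y \<ge> 0" for a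
    using assms by (simp add: green_def W_poly_def Y_poly_def mult.assoc)
  moreover have "poly (green s 0 0) y > 0"
  proof -
    have "Q_hat 1 = 1" using Q_hat_Suc[of 0] by simp
    then show ?thesis using assms by (simp add: green_def W_poly_def poly_power)
  qed
  ultimately have "(\<Sum>a\<le>s. poly (green s a a) y) > 0"
    by (intro sum_pos2[of _ 0]) auto
  then show ?thesis by (simp only: poly_sum flip: sum_green_diag)
qed

lemma y_star_pos: "y_star s > 0"
  using pole_pos[of 0 s] by (simp add: pole_0)

lemma N_cyc_even_limit:
  assumes "s \<ge> 1"
  shows "(\<lambda>m. real (N_cyc s (2 * m)) * y_star s ^ m) \<longlonglongrightarrow> 1"
proof -
  define y where "y = y_star s"
  define p where "p = poly (P_hat (s + 1)) y"
  have y: "y > 0" by (simp add: y_def y_star_pos)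
  have p: "p \<noteq> 0" using P_hat_y_star[OF assms] by (simp add: p_def y_def)
  define f where "f = smult ((real s + 2) / 2) (P_hat (s + 1))"
  have "2 * (fps_of_poly (Q_hat (s + 2)) * Psi_cyc s) = 2 * fps_of_poly f"
    using Psi_cyc_mult[of s] unfolding f_def
    by (simp add: fps_of_poly_smult mult.assoc flip: fps_numeral_fps_const)
  then have "fps_of_poly (Q_hat (s + 2)) * Psi_cyc s = fps_of_poly f" by simp
  from coefficient_limit[OF this]
  have "(\<lambda>n. real (N_cyc s (2 * (n + 1))) * y ^ n) \<longlonglongrightarrow> 2 * poly f y / ((real s + 2) * y * p)"
    by (simp add: Psi_cyc_def y_def p_def)
  also have "2 * poly f y / ((real s + 2) * y * p) = 1 / y"
  proof -
    have "2 * (k / 2 * p) / (k * y * p) = 1 / y" if "k > 0" for k :: real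
      using that y p by (simp add: field_simps)
    from this[of "real s + 2"] show ?thesis by (simp add: f_def p_def)
  qed
  finally have "(\<lambda>n. real (N_cyc s (2 * (n + 1))) * y ^ n * y) \<longlonglongrightarrow> 1 / y * y"
    by (rule tendsto_mult_right)
  then have "(\<lambda>n. real (N_cyc s (2 * Suc n)) * y ^ Suc n) \<longlonglongrightarrow> 1"
    using y by (simp add: mult_ac)
  then show ?thesis by (simp only: y_def) (rule LIMSEQ_imp_Suc)
qed

lemma N_cyc_odd_limit:
  assumes "s \<ge> 1"
  shows "(\<lambda>m. real (N_cyc s (2 * m + 1)) * y_star s ^ m) \<longlonglongrightarrow> xi s"
proof -
  have "2 * poly (R_poly s) (y_star s) / ((real s + 2) * y_star s * poly (P_hat (s + 1)) (y_star s)) = xi s"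
    unfolding P_hat_y_star(3)[OF assms] xi_def by simp
  then show ?thesis using coefficient_limit[OF trace_fps_mult[of s]] by simp
qed

lemma asymp_equivI_power:
  fixes f :: "nat \<Rightarrow> real"
  assumes "y > 0" "c \<noteq> 0" "(\<lambda>m. f m * y ^ m) \<longlonglongrightarrow> c"
  shows "asymp_equiv f at_top (\<lambda>m. c * y powi (- int m))"
proof (rule asymp_equivI')
  have "(\<lambda>m. f m * y ^ m / c) \<longlonglongrightarrow> c / c" by (intro tendsto_divide assms tendsto_const)
  then show "(\<lambda>m. f m / (c * y powi (- int m))) \<longlonglongrightarrow> 1"
    using assms by (simp add: power_int_minus field_simps)
qed

theorem theorem1p4:
  fixes s :: nat
  assumes "s \<ge> 1"
  shows
    "Psi_cyc s = fps_of_poly (smult (real s + 2) (P_hat (s + 1)))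
                   / fps_of_poly (smult 2 (Q_hat (s + 2)))
   \<and> fps_X * fps_of_poly (Q_hat (s + 2))
       dvd fps_of_poly (R_poly s - smult (real (s div 2) + 1) (Q_hat (s + 2)))
   \<and> Omega_cyc s = fps_of_poly (R_poly s - smult (real (s div 2) + 1) (Q_hat (s + 2)))
                     / (fps_X * fps_of_poly (Q_hat (s + 2)))
   \<and> asymp_equiv (\<lambda>m. real (N_cyc s (2 * m))) at_top (\<lambda>m. y_star s powi (- int m))
   \<and> asymp_equiv (\<lambda>m. real (N_cyc s (2 * m + 1))) at_top (\<lambda>m. xi s * y_star s powi (- int m))
   \<and> (\<lambda>m. real (N_cyc s (2 * m)) / y_star s powi (- int m)) \<longlonglongrightarrow> 1"
proof (intro conjI)
  have "coeff (Q_hat (s + 2)) 0 = 1" by (simp add: coeff_Q_hat)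
  then have "fps_of_poly (Q_hat (s + 2)) \<noteq> 0"
    by (metis fps_of_poly_nth fps_zero_nth zero_neq_one)
  then have nz: "fps_of_poly (smult 2 (Q_hat (s + 2))) \<noteq> 0" "fps_X * fps_of_poly (Q_hat (s + 2)) \<noteq> 0"
    by (simp_all add: fps_of_poly_smult)
  show "Psi_cyc s = fps_of_poly (smult (real s + 2) (P_hat (s + 1)))
                   / fps_of_poly (smult 2 (Q_hat (s + 2)))"
    unfolding Psi_cyc_mult[symmetric] using nz(1) by (rule nonzero_mult_div_cancel_left[symmetric])
  show "fps_X * fps_of_poly (Q_hat (s + 2))
       dvd fps_of_poly (R_poly s - smult (real (s div 2) + 1) (Q_hat (s + 2)))"
    unfolding Omega_cyc_mult[symmetric] by (rule dvd_triv_left)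
  show "Omega_cyc s = fps_of_poly (R_poly s - smult (real (s div 2) + 1) (Q_hat (s + 2)))
                     / (fps_X * fps_of_poly (Q_hat (s + 2)))"
    unfolding Omega_cyc_mult[symmetric] using nz(2) by (rule nonzero_mult_div_cancel_left[symmetric])
  show "asymp_equiv (\<lambda>m. real (N_cyc s (2 * m))) at_top (\<lambda>m. y_star s powi (- int m))"
    using asymp_equivI_power[OF y_star_pos _ N_cyc_even_limit[OF assms]] by simp
  have "xi s > 0"
    using R_poly_pos[OF y_star_pos, of s] y_star_pos[of s] P_hat_y_star(1,2)[OF assms]
    by (simp add: xi_def)
  then show "asymp_equiv (\<lambda>m. real (N_cyc s (2 * m + 1))) at_top (\<lambda>m. xi s * y_star s powi (- int m))"
    by (intro asymp_equivI_power y_star_pos N_cyc_odd_limit assms) auto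
  show "(\<lambda>m. real (N_cyc s (2 * m)) / y_star s powi (- int m)) \<longlonglongrightarrow> 1"
    using N_cyc_even_limit[OF assms] by (simp add: power_int_minus divide_inverse)
qed

end
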